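(* Let $\Omega:\mathcal{T}\to\mathcal{T}$ be a computable total map such that $\Omega(T)\in\mathcal{D}_{\mathcal{T}}$ for every $T$ and $(\Omega(T))'=T'$ whenever $T\in\mathcal{D}_{\mathcal{T}}$. There is no (stably) computable map $D:\mathcal{T}\times\mathbb{N}\to\{\pm\}$ that is stably sound and complete; that is, if $D$ is stably sound and complete then $\neg\Theta_{D,T}$ for every $T\in\mathcal{T}$.
   Context: "Map" means partial map unless called total. $\mathcal{T}$ is the set of Turing machines $\mathbb{N}\to\mathbb{N}$ with a standard Gödel encoding $e_{\mathcal{T}}$; $\mathbb{N}$ is encoded by the identity, $\{\pm\}$ by $-\mapsto0,+\mapsto1$, products by $(a,b)\mapsto2^{e_A(a)}3^{e_B(b)}$. $\mathcal{D}_{\mathcal{T}}$ is the set of $T\in\mathcal{T}$ for which there is a (unique) map $T':\mathcal{T}\times\mathbb{N}\to\{\pm\}$ with $e_{\{\pm\}}\circ T'=T\circ e_{\mathcal{T}\times\mathbb{N}}$. For a map $D:\mathcal{T}\times\mathbb{N}\to\{\pm\}$, $b\in\mathcal{T}$ is $D$-decided if there is $m$ with $D(b,m)=+$ and $D(b,n)\neq-$ for all $n\ge m$; for $S\in\mathcal{D}_{\mathcal{T}}$, $b$ is $S$-decided if it is $S'$-decided. $s(T)$ is the statement "$T$ is not $\Omega(T)$-decided". $D$ is stably sound if for all $T$, ($T$ is $D$-decided) implies $s(T)$; $D$ stably decides $T$ if $s(T)$ implies ($T$ is $D$-decided); $D$ is stably sound and complete if it is stably sound and stably decides every $T\in\mathcal{T}$.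 Two maps $\mathcal{T}\times\mathbb{N}\to\{\pm\}$ are stably equivalent if they have the same decided elements; $\Theta_{D,T}$ is the statement "$T$ stably computes $D$", i.e. $T\in\mathcal{D}_{\mathcal{T}}$ and $T'$ is stably equivalent to $D$. $D$ is (stably) computable if $\Theta_{D,T}$ holds for some $T$. *)

theory Defs
  imports "HOL-Library.Finite_Map" "HOL-Library.Nat_Bijection"
begin

datatype move = MLeft | MStay | MRight

text \<open>A deterministic one-tape Turing machine is its transition table, a finite partial map
  (state, scanned symbol) to (new state, written symbol, head move).  States and tape symbols are
  named by natural numbers; the finite state set and alphabet are the finitely many numbers
  occurring in the table, together with the initial state 0, the blank 0 and the tally symbol 1.
  A configuration consists of state, head position and two-way infinite tape.\<close>

type_synonym tm = "(nat \<times> nat, nat \<times> nat \<times> move) fmap"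
type_synonym config = "nat \<times> int \<times> (int \<Rightarrow> nat)"

fun shift :: "move \<Rightarrow> int \<Rightarrow> int" where
  "shift MLeft h = h - 1"
| "shift MStay h = h"
| "shift MRight h = h + 1"

fun step :: "tm \<Rightarrow> config \<Rightarrow> config option" where
  "step M (q, h, t) =
     map_option (\<lambda>(q', a, d). (q', shift d h, t(h := a))) (fmlookup M (q, t h))"

text \<open>The machine halts when no table entry applies; a non-halting computation yields
  \<^term>\<open>None\<close>.\<close>

partial_function (option) run :: "tm \<Rightarrow> config \<Rightarrow> config option" where
  "run M c = (case step M c of None \<Rightarrow> Some c | Some c' \<Rightarrow> run M c')"

text \<open>Numbers are presented in unary: the input \<open>n\<close> is a block of \<open>n\<close> tallies with the head on
  its leftmost cell, the output is the total number of tallies on the tape at halting.\<close>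

definition initial :: "nat \<Rightarrow> config" where
  "initial n = (0, 0, \<lambda>i. if 0 \<le> i \<and> i < int n then 1 else 0)"

definition tm_fun :: "tm \<Rightarrow> nat \<rightharpoonup> nat" where
  "tm_fun M n = map_option (\<lambda>(q, h, t). card {i. t i = 1}) (run M (initial n))"

fun move_code :: "move \<Rightarrow> nat" where
  "move_code MLeft = 0"
| "move_code MStay = 1"
| "move_code MRight = 2"

fun instr_code :: "(nat \<times> nat) \<times> (nat \<times> nat \<times> move) \<Rightarrow> nat" where
  "instr_code ((q, a), (q', a', d)) =
     prod_encode (prod_encode (q, a), prod_encode (q', prod_encode (a', move_code d)))"

text \<open>The Goedel number of a machine is the number whose binary digits 1 are at the codes of its
  instructions.\<close>

definition enc_tm :: "tm \<Rightarrow> nat" where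
  "enc_tm M = set_encode (instr_code ` fset (fset_of_fmap M))"

datatype sign = Minus | Plus

fun enc_sign :: "sign \<Rightarrow> nat" where
  "enc_sign Minus = 0"
| "enc_sign Plus = 1"

definition enc_prod :: "('a \<Rightarrow> nat) \<Rightarrow> ('b \<Rightarrow> nat) \<Rightarrow> 'a \<times> 'b \<Rightarrow> nat" where
  "enc_prod eA eB = (\<lambda>(a, b). 2 ^ eA a * 3 ^ eB b)"

text \<open>\<open>T\<close> computes the partial map \<open>f\<close> between encoded sets: \<open>e\<^sub>B \<circ> f = T \<circ> e\<^sub>A\<close> as partial maps.\<close>

definition computes :: "('a \<Rightarrow> nat) \<Rightarrow> ('b \<Rightarrow> nat) \<Rightarrow> tm \<Rightarrow> ('a \<rightharpoonup> 'b) \<Rightarrow> bool" where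
  "computes eA eB T f \<longleftrightarrow> map_option eB \<circ> f = tm_fun T \<circ> eA"

definition computable :: "('a \<Rightarrow> nat) \<Rightarrow> ('b \<Rightarrow> nat) \<Rightarrow> ('a \<rightharpoonup> 'b) \<Rightarrow> bool" where
  "computable eA eB f \<longleftrightarrow> (\<exists>T. computes eA eB T f)"

lemma inj_instr_code: "inj instr_code"
proof (rule injI)
  fix x y
  assume eq: "instr_code x = instr_code y"
  have mc: "move_code d = move_code d' \<Longrightarrow> d = d'" for d d'
    by (cases d; cases d'; simp)
  obtain q a q' a' d where x: "x = ((q, a), (q', a', d))" by (metis prod.exhaust)
  obtain r b r' b' e where y: "y = ((r, b), (r', b', e))" by (metis prod.exhaust)
  show "x = y" using eq mc unfolding x y by simp
qed

lemma inj_enc_tm: "inj enc_tm"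
proof (rule injI)
  fix M N
  assume "enc_tm M = enc_tm N"
  then have "set_encode (instr_code ` fset (fset_of_fmap M))
           = set_encode (instr_code ` fset (fset_of_fmap N))"
    by (simp add: enc_tm_def)
  then have "instr_code ` fset (fset_of_fmap M) = instr_code ` fset (fset_of_fmap N)"
    by (metis finite_fset finite_imageI set_encode_inverse)
  then have "fset (fset_of_fmap M) = fset (fset_of_fmap N)"
    by (simp add: inj_image_eq_iff inj_instr_code)
  then show "M = N"
    by (metis fset_inverse fset_of_fmap_inj injD)
qed

lemma inj_enc_sign: "inj enc_sign"
  by (rule injI) (metis enc_sign.elims zero_neq_one)

abbreviation enc_tm_nat :: "tm \<times> nat \<Rightarrow> nat" where
  "enc_tm_nat \<equiv> enc_prod enc_tm (\<lambda>n. n)"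

definition decision_machines :: "tm set" where
  "decision_machines = {T. \<exists>T'. computes enc_tm_nat enc_sign T T'}"

lemma computes_sign_unique:
  assumes "computes eA enc_sign T f" "computes eA enc_sign T g"
  shows "f = g"
proof
  fix x
  have "map_option enc_sign (f x) = map_option enc_sign (g x)"
    using assms by (metis computes_def comp_apply)
  then show "f x = g x"
    by (metis inj_enc_sign injD option.inj_map)
qed

text \<open>The map \<open>T'\<close> of the machine \<open>T\<close>, meaningful for \<open>T\<close> in \<^const>\<open>decision_machines\<close>.\<close>

definition decision_map :: "tm \<Rightarrow> tm \<times> nat \<rightharpoonup> sign" where
  "decision_map T = (THE T'. computes enc_tm_nat enc_sign T T')"

lemma computes_decision_map:
  "T \<in> decision_machines \<Longrightarrow> computes enc_tm_nat enc_sign T (decision_map T)"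
proof -
  assume "T \<in> decision_machines"
  then obtain f where f: "computes enc_tm_nat enc_sign T f"
    by (auto simp: decision_machines_def)
  show ?thesis
    unfolding decision_map_def
    by (rule theI[where P = "computes enc_tm_nat enc_sign T"], rule f) (rule computes_sign_unique[OF _ f])
qed

definition decided :: "(tm \<times> nat \<rightharpoonup> sign) \<Rightarrow> tm \<Rightarrow> bool" where
  "decided D b \<longleftrightarrow> (\<exists>m. D (b, m) = Some Plus \<and> (\<forall>n\<ge>m. D (b, n) \<noteq> Some Minus))"

definition tm_decided :: "tm \<Rightarrow> tm \<Rightarrow> bool" where
  "tm_decided S b \<longleftrightarrow> S \<in> decision_machines \<and> decided (decision_map S) b"

definition s_stmt :: "(tm \<Rightarrow> tm) \<Rightarrow> tm \<Rightarrow> bool" where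
  "s_stmt \<Omega> T \<longleftrightarrow> \<not> tm_decided (\<Omega> T) T"

definition stably_sound :: "(tm \<Rightarrow> tm) \<Rightarrow> (tm \<times> nat \<rightharpoonup> sign) \<Rightarrow> bool" where
  "stably_sound \<Omega> D \<longleftrightarrow> (\<forall>T. decided D T \<longrightarrow> s_stmt \<Omega> T)"

definition stably_decides :: "(tm \<Rightarrow> tm) \<Rightarrow> (tm \<times> nat \<rightharpoonup> sign) \<Rightarrow> tm \<Rightarrow> bool" where
  "stably_decides \<Omega> D T \<longleftrightarrow> (s_stmt \<Omega> T \<longrightarrow> decided D T)"

definition stably_sound_complete :: "(tm \<Rightarrow> tm) \<Rightarrow> (tm \<times> nat \<rightharpoonup> sign) \<Rightarrow> bool" where
  "stably_sound_complete \<Omega> D \<longleftrightarrow> stably_sound \<Omega> D \<and> (\<forall>T. stably_decides \<Omega> D T)"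

definition stably_equiv :: "(tm \<times> nat \<rightharpoonup> sign) \<Rightarrow> (tm \<times> nat \<rightharpoonup> sign) \<Rightarrow> bool" where
  "stably_equiv D E \<longleftrightarrow> (\<forall>b. decided D b \<longleftrightarrow> decided E b)"

definition stably_computes :: "(tm \<times> nat \<rightharpoonup> sign) \<Rightarrow> tm \<Rightarrow> bool" (\<open>\<Theta>\<close>) where
  "\<Theta> D T \<longleftrightarrow> T \<in> decision_machines \<and> stably_equiv (decision_map T) D"

definition stably_computable :: "(tm \<times> nat \<rightharpoonup> sign) \<Rightarrow> bool" where
  "stably_computable D \<longleftrightarrow> (\<exists>T. \<Theta> D T)"

end

theory Submission
  imports Defs
begin

text \<open>Diagonalisation: a machine \<open>T\<close> that stably computes \<open>D\<close> is
  applied to its own code. Being sound and complete at \<open>T\<close>, \<open>D\<close> decides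
  \<open>T\<close> exactly when \<open>\<Omega> T\<close> does not. But \<open>\<Omega>\<close>
  leaves the map of a decision machine unchanged, and that map decides the same elements as
  \<open>D\<close>, so \<open>D\<close> decides \<open>T\<close> exactly when it does not.\<close>

theorem theorem4p5:
  fixes \<Omega> :: "tm \<Rightarrow> tm"
  assumes "computable enc_tm enc_tm (\<lambda>T. Some (\<Omega> T))"
    and "\<And>T. \<Omega> T \<in> decision_machines"
    and "\<And>T. T \<in> decision_machines \<Longrightarrow> decision_map (\<Omega> T) = decision_map T"
  shows "(\<nexists>D. stably_computable D \<and> stably_sound_complete \<Omega> D) \<and>
    (\<forall>D. stably_sound_complete \<Omega> D \<longrightarrow> (\<forall>T. \<not> \<Theta> D T))"
proof -
  have "\<not> \<Theta> D T" if "stably_sound_complete \<Omega> D" for D T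
  proof
    assume "\<Theta> D T"
    then have T: "T \<in> decision_machines" and equiv: "decided (decision_map T) T \<longleftrightarrow> decided D T"
      by (auto simp: stably_computes_def stably_equiv_def)
    \<comment> \<open>Soundness gives the forward direction, completeness the converse.\<close>
    have "decided D T \<longleftrightarrow> \<not> tm_decided (\<Omega> T) T"
      using that by (auto simp: stably_sound_complete_def stably_sound_def stably_decides_def s_stmt_def)
    \<comment> \<open>\<open>assms(2)\<close> settles the membership conjunct of
      \<open>tm_decided\<close>; \<open>assms(3)\<close> applies because \<open>\<Theta> D T\<close>
      makes \<open>T\<close> a decision machine.\<close>
    moreover have "tm_decided (\<Omega> T) T \<longleftrightarrow> decided (decision_map T) T"
      using assms(2) assms(3)[OF T] by (simp add: tm_decided_def)
    ultimately show False
      using equiv by blast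
  qed
  then show ?thesis
    by (auto simp: stably_computable_def)
qed

end
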